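(* Let $X\subseteq\mathbb{R}^n$ and $Y\subseteq\mathbb{R}^m$ be convex, closed and nonempty sets, let $f,g_1,\dots,g_p:\mathbb{R}^m\times\mathbb{R}^n\to\,]-\infty,+\infty]$ be proper, lower semicontinuous, convex (possibly nondifferentiable), $g=(g_1,\dots,g_p)$, let $A,B$ be matrices and $b$ a vector of compatible sizes, and let $\bar x\in X$. Consider $$\mathcal{Q}(x)=\min_{y}\{f(y,x): g(y,x)\le0,\ Ay+Bx=b,\ y\in Y\},$$ the set $S=\{(y,z)\in\mathbb{R}^m\times\mathbb{R}^n: g(y,z)\le0,\ Ay+Bz=b,\ y\in Y\}$, and the dual problem $$\max_{\lambda\in\mathbb{R}^n}\theta_x(\lambda),\qquad \theta_x(\lambda)=\min\{f(y,z)+\langle\lambda,x-z\rangle:(y,z)\in S\}.$$ Assume that $\hat y$ is an $\varepsilon_P$-optimal feasible solution of the primal problem defining $\mathcal{Q}(\bar x)$ and that $\hat\lambda$ is an $\varepsilon_D$-optimal feasible solution of the dual problem written for $x=\bar x$. Assume that $f(\cdot,\bar x)$ is finite on $\{y\in Y: Ay+B\bar x=b,\ g(y,\bar x)\le0\}$ and that there exists $y_{\bar x}$ such that $(y_{\bar x},\bar x)\in\mathrm{ri}(S)$. Then $$\mathcal{C}(x)=f(\hat y,\bar x)-(\varepsilon_P+\varepsilon_D)+\langle\hat\lambda,x-\bar x\rangle$$ is an $(\varepsilon_P+\varepsilon_D)$-inexact cut for $\mathcal{Q}$ at $\bar x$.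
   Context: Definition ($\varepsilon$-inexact cut). Let $\mathcal{Q}:X\to\mathbb{R}$ be a convex function with $X\subset\mathbb{R}^n$ convex, $X\subset\mathrm{ri}(\mathrm{dom}(\mathcal{Q}))$, and let $\varepsilon\ge0$. A function $\mathcal{C}:X\to\mathbb{R}$ is an $\varepsilon$-inexact cut for $\mathcal{Q}$ at $\bar x\in X$ if $\mathcal{C}$ is affine, $\mathcal{Q}(x)\ge\mathcal{C}(x)$ for all $x\in X$, and $\mathcal{Q}(\bar x)-\mathcal{C}(\bar x)\le\varepsilon$. $\mathrm{ri}$ denotes relative interior. $\min$ and $\max$ denote optimal values (infimum/supremum). For $\varepsilon\ge 0$, an $\varepsilon$-optimal feasible solution of a minimization (resp. maximization) problem is a feasible point whose objective value is at most the optimal value plus $\varepsilon$ (resp. at least the optimal value minus $\varepsilon$); here $\varepsilon_P,\varepsilon_D\ge0$.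
   Formalization: The requirement X ⊂ ri(dom(Q)), which the definition of an inexact cut presupposes but the proposition does not state, is an explicit hypothesis; without it the inequality C ≤ Q on X can fail. *)

theory Defs
  imports "HOL-Analysis.Analysis"
begin

text \<open>Extended-real-valued functions. Convexity is convexity of the epigraph, which is meaningful
  whatever infinite values the function takes.\<close>

definition proper_fun :: "('a \<Rightarrow> ereal) \<Rightarrow> bool" where
  "proper_fun h \<longleftrightarrow> (\<forall>x. h x \<noteq> -\<infinity>) \<and> (\<exists>x. h x \<noteq> \<infinity>)"

definition lsc_fun :: "('a::topological_space \<Rightarrow> ereal) \<Rightarrow> bool" where
  "lsc_fun h \<longleftrightarrow> (\<forall>x. h x \<le> Liminf (at x) h)"

definition convex_fun :: "('a::real_vector \<Rightarrow> ereal) \<Rightarrow> bool" where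
  "convex_fun h \<longleftrightarrow> convex {(x, r::real). h x \<le> ereal r}"

definition eff_dom :: "('a \<Rightarrow> ereal) \<Rightarrow> 'a set" where
  "eff_dom h = {x. h x < \<infinity>}"

definition eps_opt_min :: "real \<Rightarrow> 'a set \<Rightarrow> ('a \<Rightarrow> ereal) \<Rightarrow> 'a \<Rightarrow> bool" where
  "eps_opt_min \<epsilon> F h u \<longleftrightarrow> u \<in> F \<and> h u \<le> (INF v\<in>F. h v) + ereal \<epsilon>"

definition eps_opt_max :: "real \<Rightarrow> 'a set \<Rightarrow> ('a \<Rightarrow> ereal) \<Rightarrow> 'a \<Rightarrow> bool" where
  "eps_opt_max \<epsilon> F h u \<longleftrightarrow> u \<in> F \<and> h u \<ge> (SUP v\<in>F. h v) - ereal \<epsilon>"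

text \<open>Inexact cuts. \<open>Q\<close> is given on the whole space with extended values, so that its effective domain
  makes sense; the first six conjuncts are the standing requirements under which the notion is
  defined (in particular \<open>Q\<close> is real-valued and convex on \<open>X\<close>), the last three are the
  cut property itself. Only the values of \<open>C\<close> on \<open>X\<close> matter.\<close>

definition inexact_cut ::
  "real \<Rightarrow> ('a::euclidean_space) set \<Rightarrow> ('a \<Rightarrow> ereal) \<Rightarrow> 'a \<Rightarrow> ('a \<Rightarrow> real) \<Rightarrow> bool" where
  "inexact_cut \<epsilon> X Q xbar C \<longleftrightarrow>
     0 \<le> \<epsilon> \<and> convex X \<and> xbar \<in> X \<and>
     (\<forall>x\<in>X. \<bar>Q x\<bar> \<noteq> \<infinity>) \<and> convex_on X (\<lambda>x. real_of_ereal (Q x)) \<and>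
     X \<subseteq> rel_interior (eff_dom Q) \<and>
     (\<exists>l c. linear l \<and> (\<forall>x\<in>X. C x = l x + c)) \<and>
     (\<forall>x\<in>X. ereal (C x) \<le> Q x) \<and>
     Q xbar - ereal (C xbar) \<le> ereal \<epsilon>"

text \<open>The problem data are \<open>f\<close>, \<open>g\<close> (indexed by a finite type), \<open>A\<close>, \<open>B\<close>, \<open>b\<close> and \<open>Y\<close>;
  the decision variable \<open>y\<close> is the first component of the argument of \<open>f\<close> and \<open>g\<close>.\<close>

definition feas ::
  "('p \<Rightarrow> (real^'m) \<times> (real^'n) \<Rightarrow> ereal) \<Rightarrow> real^'m^'q \<Rightarrow> real^'n^'q \<Rightarrow> real^'q \<Rightarrow>
   (real^'m) set \<Rightarrow> real^'n \<Rightarrow> (real^'m) set" where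
  "feas g A B b Y x = {y. (\<forall>i. g i (y, x) \<le> 0) \<and> A *v y + B *v x = b \<and> y \<in> Y}"

definition value_fun ::
  "((real^'m) \<times> (real^'n) \<Rightarrow> ereal) \<Rightarrow> ('p \<Rightarrow> (real^'m) \<times> (real^'n) \<Rightarrow> ereal) \<Rightarrow>
   real^'m^'q \<Rightarrow> real^'n^'q \<Rightarrow> real^'q \<Rightarrow> (real^'m) set \<Rightarrow> real^'n \<Rightarrow> ereal" where
  "value_fun f g A B b Y x = (INF y\<in>feas g A B b Y x. f (y, x))"

definition joint_feas ::
  "('p \<Rightarrow> (real^'m) \<times> (real^'n) \<Rightarrow> ereal) \<Rightarrow> real^'m^'q \<Rightarrow> real^'n^'q \<Rightarrow> real^'q \<Rightarrow>
   (real^'m) set \<Rightarrow> ((real^'m) \<times> (real^'n)) set" where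
  "joint_feas g A B b Y =
     {(y, z). (\<forall>i. g i (y, z) \<le> 0) \<and> A *v y + B *v z = b \<and> y \<in> Y}"

definition dual_fun ::
  "((real^'m) \<times> (real^'n) \<Rightarrow> ereal) \<Rightarrow> ((real^'m) \<times> (real^'n)) set \<Rightarrow> real^'n \<Rightarrow> real^'n \<Rightarrow> ereal"
  where
  "dual_fun f S x l = (INF (y, z)\<in>S. f (y, z) + ereal (l \<bullet> (x - z)))"

end

theory Submission
  imports Defs
begin

text \<open>The value function \<open>Q\<close> is the marginal of a jointly convex function over the convex set \<open>S\<close>,
  hence convex (\<open>convex_fun_marginal\<close>). It is finite at \<open>xbar\<close>, because a primal point of finite cost
  is within \<open>\<epsilon>P\<close> of \<open>Q xbar\<close>, and \<open>xbar\<close> lies in the relative interior of its effective domain;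
  so \<open>Q\<close> has a subgradient \<open>s\<close> at \<open>xbar\<close> (\<open>convex_fun_subgradient\<close>). This has two consequences.

  First, \<open>Q\<close> has an affine minorant, so it never takes the value \<open>-\<infinity>\<close> and is real-valued on
  its effective domain, which contains \<open>X\<close>.

  Second, there is no duality gap at \<open>xbar\<close>. The dual function dualizes the constraint \<open>z = xbar\<close>
  on the copy \<open>z\<close> of the parameter, so a subgradient of \<open>Q\<close> at \<open>xbar\<close> is precisely
  a multiplier of dual value at least \<open>Q xbar\<close> (\<open>value_fun_le_dual_fun_subgradient\<close>).
  Therefore \<open>lhat\<close> has dual value at least \<open>Q xbar - \<epsilon>D\<close>, hence at least \<open>f (yhat, xbar) - \<epsilon>P - \<epsilon>D\<close>.
  Finally, weak duality, read as a statement about all parameters rather than about \<open>xbar\<close> alone, says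
  that each multiplier \<open>l\<close> gives the affine minorant
  \<open>x \<mapsto> dual_fun f S xbar l + l \<bullet> (x - xbar)\<close> of \<open>Q\<close> (\<open>dual_fun_le_value_fun\<close>).
  Taking \<open>l = lhat\<close> proves that the cut lies below \<open>Q\<close>, and at \<open>xbar\<close> the error is at most
  \<open>\<epsilon>P + \<epsilon>D\<close> since \<open>Q xbar \<le> f (yhat, xbar)\<close>.\<close>

section \<open>Convex extended-real-valued functions\<close>

lemma convex_funD:
  assumes "convex_fun h" "h x \<le> ereal r" "h y \<le> ereal s" "0 \<le> u" "0 \<le> v" "u + v = 1"
  shows "h (u *\<^sub>R x + v *\<^sub>R y) \<le> ereal (u * r + v * s)"
  using assms convexD[of "{(x, r::real). h x \<le> ereal r}" "(x, r)" "(y, s)" u v]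
  by (auto simp: convex_fun_def)

lemma convex_fun_convex_sublevel:
  assumes "convex_fun h"
  shows "convex {x. h x \<le> ereal c}"
proof (rule convexI)
  fix x y and u v :: real
  assume *: "x \<in> {x. h x \<le> ereal c}" "y \<in> {x. h x \<le> ereal c}" "0 \<le> u" "0 \<le> v" "u + v = 1"
  then have "h (u *\<^sub>R x + v *\<^sub>R y) \<le> ereal (u * c + v * c)"
    using assms by (intro convex_funD) auto
  also have "u * c + v * c = c"
    using \<open>u + v = 1\<close> by (metis distrib_right mult_1)
  finally show "u *\<^sub>R x + v *\<^sub>R y \<in> {x. h x \<le> ereal c}" by simp
qed

lemma eff_dom_real_bound:
  assumes "x \<in> eff_dom h"
  obtains r :: real where "h x \<le> ereal r"
  using assms unfolding eff_dom_def by (cases "h x") auto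

lemma convex_fun_convex_eff_dom:
  assumes "convex_fun h"
  shows "convex (eff_dom h)"
proof (rule convexI)
  fix x y and u v :: real
  assume *: "x \<in> eff_dom h" "y \<in> eff_dom h" "0 \<le> u" "0 \<le> v" "u + v = 1"
  then obtain r s :: real where "h x \<le> ereal r" "h y \<le> ereal s"
    using eff_dom_real_bound by metis
  then have "h (u *\<^sub>R x + v *\<^sub>R y) \<le> ereal (u * r + v * s)"
    using assms * by (intro convex_funD) auto
  then show "u *\<^sub>R x + v *\<^sub>R y \<in> eff_dom h"
    unfolding eff_dom_def by (auto intro: le_less_trans)
qed

lemma convex_fun_imp_convex_on:
  assumes "convex_fun h" "convex X" "\<And>x. x \<in> X \<Longrightarrow> \<bar>h x\<bar> \<noteq> \<infinity>"
  shows "convex_on X (\<lambda>x. real_of_ereal (h x))"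
proof -
  have "real_of_ereal (h (u *\<^sub>R x + v *\<^sub>R y)) \<le> u * real_of_ereal (h x) + v * real_of_ereal (h y)"
    if *: "x \<in> X" "y \<in> X" "0 \<le> u" "0 \<le> v" "u + v = 1" for x y and u v :: real
  proof -
    have fin: "h w = ereal (real_of_ereal (h w))" if "w \<in> X" for w
      using assms(3)[OF that] by (simp add: ereal_real)
    have "u *\<^sub>R x + v *\<^sub>R y \<in> X"
      using convexD[OF assms(2)] * by blast
    moreover have "h (u *\<^sub>R x + v *\<^sub>R y) \<le> ereal (u * real_of_ereal (h x) + v * real_of_ereal (h y))"
      using assms(1) fin * by (intro convex_funD) auto
    ultimately show ?thesis
      using fin by (metis ereal_less_eq(3))
  qed
  then show ?thesis
    using assms(2) unfolding convex_on_def by blast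
qed

text \<open>Infima need not be attained, so the two points of the epigraph are matched with feasible points
  that exceed the prescribed heights by an arbitrarily small \<open>e\<close>.\<close>

lemma convex_fun_marginal:
  fixes F :: "'a::real_vector \<times> 'b::real_vector \<Rightarrow> ereal"
  assumes F: "convex_fun F" and S: "convex S"
  shows "convex_fun (\<lambda>z. INF y\<in>{y. (y, z) \<in> S}. F (y, z))"
proof -
  let ?m = "\<lambda>z. INF y\<in>{y. (y, z) \<in> S}. F (y, z)"
  have near: "\<exists>y. (y, z) \<in> S \<and> F (y, z) \<le> ereal (r + e)" if "?m z \<le> ereal r" "0 < e" for z r e
  proof -
    have "?m z < ereal (r + e)"
      using that by (auto intro: le_less_trans)
    then show ?thesis
      unfolding INF_less_iff by (auto intro: less_imp_le)
  qed
  have "?m (u *\<^sub>R z + v *\<^sub>R w) \<le> ereal (u * r + v * s)"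
    if *: "?m z \<le> ereal r" "?m w \<le> ereal s" "0 \<le> u" "0 \<le> v" "u + v = 1"
    for z w and r s u v :: real
  proof (rule ereal_le_epsilon2)
    fix e :: real assume "0 < e"
    obtain y where y: "(y, z) \<in> S" "F (y, z) \<le> ereal (r + e)"
      using near[OF *(1) \<open>0 < e\<close>] by blast
    obtain y' where y': "(y', w) \<in> S" "F (y', w) \<le> ereal (s + e)"
      using near[OF *(2) \<open>0 < e\<close>] by blast
    have in_S: "(u *\<^sub>R y + v *\<^sub>R y', u *\<^sub>R z + v *\<^sub>R w) \<in> S"
      using convexD[OF S y(1) y'(1) *(3-5)] by simp
    have "?m (u *\<^sub>R z + v *\<^sub>R w) \<le> F (u *\<^sub>R y + v *\<^sub>R y', u *\<^sub>R z + v *\<^sub>R w)"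
      using in_S by (intro INF_lower) simp
    also have "\<dots> \<le> ereal (u * (r + e) + v * (s + e))"
      using convex_funD[OF F y(2) y'(2) *(3-5)] by simp
    also have "u * (r + e) + v * (s + e) = u * r + v * s + (u + v) * e"
      by (simp add: algebra_simps)
    finally show "?m (u *\<^sub>R z + v *\<^sub>R w) \<le> ereal (u * r + v * s) + ereal e"
      using *(5) by simp
  qed
  then show ?thesis
    unfolding convex_fun_def by (intro convexI) auto
qed

section \<open>Subgradients on the relative interior of the effective domain\<close>

text \<open>A point \<open>(x, h x)\<close> of the graph is on the relative boundary of the epigraph, so there is a
  hyperplane with normal \<open>(a, t)\<close> that supports the epigraph there and does not contain it.
  The hyperplane cannot be vertical: with \<open>t = 0\<close> the functional \<open>a\<close> would attain its minimum
  over the effective domain at the relative interior point \<open>x\<close>, hence be constant there, and then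
  the hyperplane would contain the epigraph. Rescaling by \<open>t > 0\<close> turns it into the graph of an
  affine minorant. Points where \<open>h\<close> is \<open>-\<infinity>\<close> are not excluded beforehand; the supporting
  inequality rules them out.\<close>

lemma convex_fun_subgradient:
  fixes h :: "'a::euclidean_space \<Rightarrow> ereal"
  assumes h: "convex_fun h" and x: "x \<in> rel_interior (eff_dom h)" and hx: "h x = ereal q"
  obtains s where "\<And>z. ereal (q + s \<bullet> (z - x)) \<le> h z"
proof -
  define E where "E = {(z, r::real). h z \<le> ereal r}"
  have "convex E"
    using h unfolding E_def convex_fun_def .
  have xqE: "(x, q) \<in> E" and xq1E: "(x, q + 1) \<in> E"
    using hx by (auto simp: E_def)
  \<comment> \<open>Prolonging the segment from \<open>(x, q + 1)\<close> beyond \<open>(x, q)\<close> leaves the epigraph.\<close>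
  have "(x, q) \<notin> rel_interior E"
  proof
    assume "(x, q) \<in> rel_interior E"
    then obtain e where "e > 1" "(1 - e) *\<^sub>R (x, q + 1) + e *\<^sub>R (x, q) \<in> E"
      using convex_rel_interior_iff[OF \<open>convex E\<close>] xqE xq1E by blast
    moreover have "(1 - e) *\<^sub>R (x, q + 1) + e *\<^sub>R (x, q) = (x, q + 1 - e)"
      by (simp add: algebra_simps)
    ultimately have "(x, q + 1 - e) \<in> E" by simp
    then show False
      using hx \<open>e > 1\<close> by (simp add: E_def)
  qed
  then obtain p where p: "\<And>w. w \<in> E \<Longrightarrow> p \<bullet> (x, q) \<le> p \<bullet> w"
      "\<And>w. w \<in> rel_interior E \<Longrightarrow> p \<bullet> (x, q) < p \<bullet> w"
    using supporting_hyperplane_rel_boundary[OF \<open>convex E\<close> xqE] by metis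
  obtain a t where "p = (a, t)" by (cases p)
  then have le: "a \<bullet> x + t * q \<le> a \<bullet> z + t * r" if "h z \<le> ereal r" for z r
    using p(1)[of "(z, r)"] that by (auto simp: E_def)
  have "t \<ge> 0"
    using le[of x "q + 1"] hx by (simp add: algebra_simps)
  moreover have "t \<noteq> 0"
  proof
    assume "t = 0"
    have min: "a \<bullet> x \<le> a \<bullet> z" if "z \<in> eff_dom h" for z
    proof -
      obtain r :: real where "h z \<le> ereal r"
        using \<open>z \<in> eff_dom h\<close> by (rule eff_dom_real_bound)
      with le[of z r] \<open>t = 0\<close> show ?thesis by simp
    qed
    obtain z r where zr: "(z, r) \<in> rel_interior E"
      using rel_interior_eq_empty[OF \<open>convex E\<close>] xqE by fastforce
    then have less: "a \<bullet> x < a \<bullet> z"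
      using p(2)[OF zr] \<open>p = (a, t)\<close> \<open>t = 0\<close> by simp
    have "(z, r) \<in> E"
      using zr rel_interior_subset by blast
    then have z: "z \<in> eff_dom h"
      unfolding E_def eff_dom_def by (auto intro: le_less_trans)
    then obtain e where "e > 1" "(1 - e) *\<^sub>R z + e *\<^sub>R x \<in> eff_dom h"
      using convex_rel_interior_iff[OF convex_fun_convex_eff_dom[OF h]] x by blast
    then have "a \<bullet> x \<le> (1 - e) * (a \<bullet> z) + e * (a \<bullet> x)"
      using min by (fastforce simp: inner_add_right)
    then have "(e - 1) * (a \<bullet> z) \<le> (e - 1) * (a \<bullet> x)"
      by (simp add: algebra_simps)
    then show False
      using less \<open>e > 1\<close> by simp
  qed
  ultimately have "t > 0" by simp
  show thesis
  proof (rule that)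
    fix z
    show "ereal (q + ((- 1 / t) *\<^sub>R a) \<bullet> (z - x)) \<le> h z"
    proof (rule ereal_le_real)
      fix r assume "h z \<le> ereal r"
      then have "a \<bullet> x + t * q \<le> a \<bullet> z + t * r" by (rule le)
      then have "t * q - a \<bullet> (z - x) \<le> t * r" by (simp add: inner_diff_right)
      then show "ereal (q + ((- 1 / t) *\<^sub>R a) \<bullet> (z - x)) \<le> ereal r"
        using \<open>t > 0\<close> by (simp add: field_simps)
    qed
  qed
qed

section \<open>The value function and its dual\<close>

lemma feas_eq_joint_feas_slice:
  "feas g A B b Y x = {y. (y, x) \<in> joint_feas g A B b Y}"
  by (auto simp: feas_def joint_feas_def)

lemma convex_joint_feas:
  fixes A :: "real^'m^'q" and B :: "real^'n^'q"
  assumes "\<And>i. convex_fun (g i)" "convex Y"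
  shows "convex (joint_feas g A B b Y)"
proof -
  have "joint_feas g A B b Y =
      (\<Inter>i. {w. g i w \<le> ereal 0}) \<inter> ((\<lambda>w. A *v fst w + B *v snd w) -` {b}) \<inter> (Y \<times> UNIV)"
    by (auto simp: joint_feas_def zero_ereal_def)
  moreover have "linear (\<lambda>w. A *v fst w + B *v snd w)"
    by (rule linearI)
      (auto simp: matrix_vector_right_distrib scaleR_right_distrib matrix_vector_mult_scaleR)
  ultimately show ?thesis
    using assms
    by (auto intro!: convex_Int convex_INT convex_Times convex_linear_vimage
        convex_fun_convex_sublevel)
qed

lemma convex_fun_value_fun:
  assumes "convex_fun f" "\<And>i. convex_fun (g i)" "convex Y"
  shows "convex_fun (value_fun f g A B b Y)"
  using convex_fun_marginal[OF assms(1) convex_joint_feas[OF assms(2,3), where A = A and B = B and b = b]]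
  unfolding value_fun_def[abs_def] feas_eq_joint_feas_slice .

text \<open>Weak duality for all parameters at once: the infimum that defines the dual function at \<open>x0\<close> ranges
  over all pairs \<open>(y, x)\<close>, so it bounds the cost at any parameter \<open>x\<close>, up to a term linear in
  \<open>x - x0\<close>.\<close>

lemma dual_fun_le_value_fun:
  assumes "ereal c \<le> dual_fun f (joint_feas g A B b Y) x0 l"
  shows "ereal (c + l \<bullet> (x - x0)) \<le> value_fun f g A B b Y x"
  unfolding value_fun_def
proof (rule INF_greatest)
  fix y assume "y \<in> feas g A B b Y x"
  then have "(y, x) \<in> joint_feas g A B b Y"
    by (simp add: feas_eq_joint_feas_slice)
  then have "dual_fun f (joint_feas g A B b Y) x0 l \<le> f (y, x) + ereal (l \<bullet> (x0 - x))"
    unfolding dual_fun_def by (intro INF_lower2[of "(y, x)"]) auto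
  with assms have "ereal c \<le> f (y, x) + ereal (l \<bullet> (x0 - x))"
    by (rule order_trans)
  then show "ereal (c + l \<bullet> (x - x0)) \<le> f (y, x)"
    by (cases "f (y, x)") (auto simp: inner_diff_right)
qed

text \<open>The converse: the slope of an affine minorant of the value function is a multiplier whose dual
  value is at least the value \<open>q\<close> of the minorant at \<open>x0\<close>. When the minorant is exact
  at \<open>x0\<close>, this closes the duality gap.\<close>

lemma value_fun_le_dual_fun_subgradient:
  assumes "\<And>z. ereal (q + s \<bullet> (z - x0)) \<le> value_fun f g A B b Y z"
  shows "ereal q \<le> dual_fun f (joint_feas g A B b Y) x0 s"
  unfolding dual_fun_def
proof (rule INF_greatest, clarify)
  fix y z assume "(y, z) \<in> joint_feas g A B b Y"
  then have "value_fun f g A B b Y z \<le> f (y, z)"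
    unfolding value_fun_def by (intro INF_lower) (simp add: feas_eq_joint_feas_slice)
  with assms have "ereal (q + s \<bullet> (z - x0)) \<le> f (y, z)"
    by (rule order_trans)
  then show "ereal q \<le> f (y, z) + ereal (s \<bullet> (x0 - z))"
    by (cases "f (y, z)") (auto simp: inner_diff_right)
qed

section \<open>The inexact cut\<close>

theorem proposition2p3:
  fixes X :: "(real^'n) set" and Y :: "(real^'m) set"
    and f :: "(real^'m) \<times> (real^'n) \<Rightarrow> ereal"
    and g :: "'p::finite \<Rightarrow> (real^'m) \<times> (real^'n) \<Rightarrow> ereal"
    and A :: "real^'m^'q" and B :: "real^'n^'q" and b :: "real^'q"
    and xbar lhat :: "real^'n" and yhat :: "real^'m"
    and \<epsilon>P \<epsilon>D :: real
  defines "Q \<equiv> value_fun f g A B b Y"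
    and "S \<equiv> joint_feas g A B b Y"
  assumes "convex X" "closed X" "X \<noteq> {}"
    and "convex Y" "closed Y" "Y \<noteq> {}"
    and "proper_fun f" "lsc_fun f" "convex_fun f"
    and "\<And>i. proper_fun (g i)" "\<And>i. lsc_fun (g i)" "\<And>i. convex_fun (g i)"
    and "xbar \<in> X"
    and "X \<subseteq> rel_interior (eff_dom Q)"
    and "0 \<le> \<epsilon>P" "0 \<le> \<epsilon>D"
    and "eps_opt_min \<epsilon>P (feas g A B b Y xbar) (\<lambda>y. f (y, xbar)) yhat"
    and "eps_opt_max \<epsilon>D UNIV (dual_fun f S xbar) lhat"
    and "\<And>y. y \<in> feas g A B b Y xbar \<Longrightarrow> \<bar>f (y, xbar)\<bar> \<noteq> \<infinity>"
    and "\<exists>y. (y, xbar) \<in> rel_interior S"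
  shows "inexact_cut (\<epsilon>P + \<epsilon>D) X Q xbar
    (\<lambda>x. real_of_ereal (f (yhat, xbar)) - (\<epsilon>P + \<epsilon>D) + lhat \<bullet> (x - xbar))"
proof -
  note feasible = assms(19) and dual = assms(20) and finite_cost = assms(21)
  define F where "F = feas g A B b Y xbar"
  define \<phi> where "\<phi> = real_of_ereal (f (yhat, xbar))"
  have yhat: "yhat \<in> F" "f (yhat, xbar) \<le> Q xbar + ereal \<epsilon>P"
    using feasible by (auto simp: eps_opt_min_def Q_def value_fun_def F_def)
  have \<phi>: "f (yhat, xbar) = ereal \<phi>"
    using finite_cost yhat(1) unfolding \<phi>_def F_def by (simp add: ereal_real)
  have "Q xbar \<le> ereal \<phi>"
    using yhat(1) unfolding Q_def value_fun_def \<phi>[symmetric] F_def by (rule INF_lower)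
  then obtain q where q: "Q xbar = ereal q" "q \<le> \<phi>" "\<phi> \<le> q + \<epsilon>P"
    using yhat(2) \<phi> by (cases "Q xbar") auto

  have Q_convex: "convex_fun Q"
    unfolding Q_def using assms by (intro convex_fun_value_fun) auto
  have "xbar \<in> rel_interior (eff_dom Q)"
    using assms by blast
  then obtain s where s: "\<And>z. ereal (q + s \<bullet> (z - xbar)) \<le> Q z"
    using convex_fun_subgradient[OF Q_convex _ q(1)] by blast

  have Q_finite: "\<bar>Q x\<bar> \<noteq> \<infinity>" if "x \<in> X" for x
  proof -
    have "x \<in> eff_dom Q"
      using that assms rel_interior_subset by blast
    then show ?thesis
      using s[of x] unfolding eff_dom_def by (cases "Q x") auto
  qed

  have "ereal q \<le> dual_fun f S xbar s"
    using s unfolding Q_def S_def by (rule value_fun_le_dual_fun_subgradient)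
  also have "\<dots> \<le> (SUP l. dual_fun f S xbar l)"
    by (rule SUP_upper) simp
  finally have "ereal q - ereal \<epsilon>D \<le> (SUP l. dual_fun f S xbar l) - ereal \<epsilon>D"
    by (rule ereal_minus_mono) simp
  also have "\<dots> \<le> dual_fun f S xbar lhat"
    using dual by (simp add: eps_opt_max_def)
  finally have "ereal (q - \<epsilon>D) \<le> dual_fun f S xbar lhat"
    by simp
  moreover have "ereal (\<phi> - (\<epsilon>P + \<epsilon>D)) \<le> ereal (q - \<epsilon>D)"
    using q(3) by simp
  ultimately have "ereal (\<phi> - (\<epsilon>P + \<epsilon>D)) \<le> dual_fun f S xbar lhat"
    by (rule order_trans[rotated])
  then have below: "ereal (\<phi> - (\<epsilon>P + \<epsilon>D) + lhat \<bullet> (x - xbar)) \<le> Q x" for x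
    unfolding S_def Q_def by (rule dual_fun_le_value_fun)

  have "linear (\<lambda>x. lhat \<bullet> x)"
    by (intro bounded_linear.linear bounded_linear_inner_right)
  moreover have "\<phi> - (\<epsilon>P + \<epsilon>D) + lhat \<bullet> (x - xbar) = lhat \<bullet> x + (\<phi> - (\<epsilon>P + \<epsilon>D) - lhat \<bullet> xbar)" for x
    by (simp add: inner_diff_right)
  ultimately have cut_affine:
    "\<exists>l c. linear l \<and> (\<forall>x\<in>X. \<phi> - (\<epsilon>P + \<epsilon>D) + lhat \<bullet> (x - xbar) = l x + c)"
    by blast

  have "convex_on X (\<lambda>x. real_of_ereal (Q x))"
    using Q_convex \<open>convex X\<close> Q_finite by (rule convex_fun_imp_convex_on)
  then show ?thesis
    unfolding inexact_cut_def \<phi>_def[symmetric]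
    using assms(3,15-18) Q_finite below cut_affine q by auto
qed

end
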